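(* Let $m\geq 3$ and $r\geq 1$ be odd integers. Then $\chi_{la}(rK_{m,m})=3$.
   Context: All graphs are simple and finite. Let $G=(V,E)$ be a graph without isolated vertices. For a bijection $f:E\to\{1,2,\dots,|E|\}$ and a vertex $u$, the weight of $u$ is $w(u)=\sum_{e\in E(u)}f(e)$, where $E(u)$ is the set of edges incident to $u$. The bijection $f$ is a local antimagic labeling of $G$ if $w(u)\neq w(v)$ for every edge $uv\in E$; it then induces a proper vertex coloring of $G$ in which $v$ gets color $w(v)$. The local antimagic chromatic number $\chi_{la}(G)$ is the minimum number of distinct colors (distinct values of $w$) over all local antimagic labelings of $G$. $K_{m,m}$ is the complete bipartite graph with both parts of size $m$, and $rK_{m,m}$ is the disjoint union of $r$ copies of $K_{m,m}$ (the labels $1,\dots,rm^2$ being used across the whole graph). *)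

theory Defs
  imports Main
begin

type_synonym 'a ugraph = "'a set \<times> 'a set set"

definition verts :: "'a ugraph \<Rightarrow> 'a set" where
  "verts G = fst G"

definition edges :: "'a ugraph \<Rightarrow> 'a set set" where
  "edges G = snd G"

definition fin_simple_graph :: "'a ugraph \<Rightarrow> bool" where
  "fin_simple_graph G \<longleftrightarrow>
     finite (verts G) \<and> (\<forall>e\<in>edges G. e \<subseteq> verts G \<and> card e = 2)"

definition incident_edges :: "'a ugraph \<Rightarrow> 'a \<Rightarrow> 'a set set" where
  "incident_edges G u = {e \<in> edges G. u \<in> e}"

definition no_isolated_verts :: "'a ugraph \<Rightarrow> bool" where
  "no_isolated_verts G \<longleftrightarrow> (\<forall>u\<in>verts G. incident_edges G u \<noteq> {})"

definition weight :: "'a ugraph \<Rightarrow> ('a set \<Rightarrow> nat) \<Rightarrow> 'a \<Rightarrow> nat" where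
  "weight G f u = (\<Sum>e\<in>incident_edges G u. f e)"

definition local_antimagic_labeling :: "'a ugraph \<Rightarrow> ('a set \<Rightarrow> nat) \<Rightarrow> bool" where
  "local_antimagic_labeling G f \<longleftrightarrow>
     bij_betw f (edges G) {1..card (edges G)} \<and>
     (\<forall>u v. {u, v} \<in> edges G \<longrightarrow> weight G f u \<noteq> weight G f v)"

text \<open>Since \<open>Inf {} = 0\<close> on \<^typ>\<open>nat\<close>, a finite graph with at least one vertex has
  value \<open>0\<close> exactly when it admits no local antimagic labeling; a positive value
  is always attained.\<close>

definition local_antimagic_chromatic_number :: "'a ugraph \<Rightarrow> nat" where
  "local_antimagic_chromatic_number G =
     Inf {card (weight G f ` verts G) | f. local_antimagic_labeling G f}"

definition complete_bipartite :: "nat \<Rightarrow> nat \<Rightarrow> (nat + nat) ugraph" where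
  "complete_bipartite m n =
     ({..<m} <+> {..<n}, {{Inl i, Inr j} | i j. i < m \<and> j < n})"

definition disjoint_copies :: "nat \<Rightarrow> 'a ugraph \<Rightarrow> (nat \<times> 'a) ugraph" where
  "disjoint_copies r G =
     ({..<r} \<times> verts G, {Pair k ` e | k e. k < r \<and> e \<in> edges G})"

lemma fin_simple_graph_complete_bipartite:
  "fin_simple_graph (complete_bipartite m n)"
  by (auto simp: fin_simple_graph_def complete_bipartite_def verts_def edges_def)

lemma no_isolated_verts_complete_bipartite:
  assumes "0 < m" "0 < n"
  shows "no_isolated_verts (complete_bipartite m n)"
  unfolding no_isolated_verts_def
proof
  fix u assume "u \<in> verts (complete_bipartite m n)"
  then consider i where "u = Inl i" "i < m" | j where "u = Inr j" "j < n"
    by (auto simp: verts_def complete_bipartite_def)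
  then have "\<exists>i j. i < m \<and> j < n \<and> (u = Inl i \<or> u = Inr j)"
    using assms by cases blast+
  then obtain i j where "i < m" "j < n" "u = Inl i \<or> u = Inr j"
    by blast
  then have "{Inl i, Inr j} \<in> incident_edges (complete_bipartite m n) u"
    unfolding incident_edges_def edges_def complete_bipartite_def snd_conv by blast
  then show "incident_edges (complete_bipartite m n) u \<noteq> {}"
    by blast
qed

lemma fin_simple_graph_disjoint_copies:
  assumes "fin_simple_graph G"
  shows "fin_simple_graph (disjoint_copies r G)"
  using assms
  by (auto simp: fin_simple_graph_def disjoint_copies_def verts_def edges_def
      card_image inj_on_def)

lemma no_isolated_verts_disjoint_copies:
  assumes "no_isolated_verts G"
  shows "no_isolated_verts (disjoint_copies r G)"
  unfolding no_isolated_verts_def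
proof
  fix v assume "v \<in> verts (disjoint_copies r G)"
  then obtain k u where v: "v = (k, u)" "k < r" "u \<in> verts G"
    by (auto simp: verts_def disjoint_copies_def)
  then obtain e where "e \<in> edges G" "u \<in> e"
    using assms by (auto simp: no_isolated_verts_def incident_edges_def)
  then have "Pair k ` e \<in> incident_edges (disjoint_copies r G) v"
    using v unfolding incident_edges_def edges_def disjoint_copies_def snd_conv by blast
  then show "incident_edges (disjoint_copies r G) v \<noteq> {}"
    by blast
qed

lemma card_edges_disjoint_copies_complete_bipartite:
  "card (edges (disjoint_copies r (complete_bipartite m n))) = r * (m * n)"
proof -
  let ?K = "disjoint_copies r (complete_bipartite m n)"
  let ?h = "\<lambda>(k, i, j). {(k, Inl i), (k, Inr j)} :: (nat \<times> (nat + nat)) set"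
  let ?A = "{..<r} \<times> {..<m} \<times> {..<n}"
  have "e \<in> edges ?K \<longleftrightarrow> e \<in> ?h ` ?A" for e
  proof
    assume "e \<in> edges ?K"
    then obtain k i j where "k < r" "i < m" "j < n" "e = ?h (k, i, j)"
      by (auto simp: disjoint_copies_def complete_bipartite_def edges_def)
    then show "e \<in> ?h ` ?A"
      by (intro image_eqI[of _ _ "(k, i, j)"]) auto
  next
    assume "e \<in> ?h ` ?A"
    then obtain k i j where *: "k < r" "i < m" "j < n" "e = {(k, Inl i), (k, Inr j)}"
      by auto
    then have "e = Pair k ` {Inl i, Inr j}"
      by simp
    with * show "e \<in> edges ?K"
      unfolding disjoint_copies_def complete_bipartite_def edges_def snd_conv by blast
  qed
  then have "edges ?K = ?h ` ?A"
    by blast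
  moreover have "inj_on ?h ?A"
    by (auto simp: inj_on_def doubleton_eq_iff)
  ultimately show ?thesis
    by (simp add: card_image card_cartesian_product)
qed

end

theory Submission
  imports Defs "HOL-Number_Theory.Cong"
begin

text \<open>
  Lower bound: in one component the two sides use disjoint sets of colors, and both sides have
  the same total weight and the same size; with two colors each side would be monochromatic, which
  is impossible.

  Upper bound: for odd \<open>m\<close> the square \<open>M i j = (i + j) mod m + m * ((i - 1 - j) mod m)\<close> contains
  \<open>0, \<dots>, m\<^sup>2 - 1\<close> and has constant row and column sums, and its row \<open>0\<close> is an arithmetic
  progression. Rotating that row by one place changes \<open>m - 1\<close> column sums by the common difference
  and the last one by \<open>m - 1\<close> times its negative, and it leaves all row sums unchanged; so three
  colors suffice for one component. The components are told apart by adding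
  \<open>m\<^sup>2 * \<sigma>\<^sub>l k\<close> in component \<open>k\<close>, where \<open>l = (i + j) mod m\<close> and the \<open>m\<close> permutations \<open>\<sigma>\<^sub>l\<close> of
  \<open>{0..<r}\<close> have a constant sum (a Kotzig array), so that all rows and columns change equally.
\<close>

section \<open>Weights in disjoint copies of a complete bipartite graph\<close>

abbreviation copies :: "nat \<Rightarrow> nat \<Rightarrow> nat \<Rightarrow> (nat \<times> (nat + nat)) ugraph" where
  "copies r m n \<equiv> disjoint_copies r (complete_bipartite m n)"

definition cell_edge :: "nat \<Rightarrow> nat \<Rightarrow> nat \<Rightarrow> (nat \<times> (nat + nat)) set" where
  "cell_edge k i j = {(k, Inl i), (k, Inr j)}"

lemma cell_edge_eq_iff [simp]:
  "cell_edge k i j = cell_edge k' i' j' \<longleftrightarrow> k = k' \<and> i = i' \<and> j = j'"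
  by (auto simp: cell_edge_def doubleton_eq_iff)

lemma edges_copies:
  "edges (copies r m n) = {cell_edge k i j | k i j. k < r \<and> i < m \<and> j < n}" (is "_ = ?S")
proof -
  have "e \<in> edges (copies r m n) \<longleftrightarrow> e \<in> ?S" for e
  proof
    assume "e \<in> edges (copies r m n)"
    then show "e \<in> ?S"
      by (auto simp: disjoint_copies_def complete_bipartite_def edges_def cell_edge_def)
  next
    assume "e \<in> ?S"
    then obtain k i j where *: "k < r" "i < m" "j < n" "e = cell_edge k i j"
      by blast
    then have "e = Pair k ` {Inl i, Inr j}"
      by (simp add: cell_edge_def)
    with * show "e \<in> edges (copies r m n)"
      unfolding disjoint_copies_def complete_bipartite_def edges_def snd_conv by blast
  qed
  then show ?thesis
    by blast
qed

lemma weight_copies_Inl: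
  assumes "k < r" "i < m"
  shows "weight (copies r m n) f (k, Inl i) = (\<Sum>j<n. f (cell_edge k i j))"
proof -
  have "incident_edges (copies r m n) (k, Inl i) = cell_edge k i ` {..<n}"
    using assms unfolding incident_edges_def edges_copies by (auto simp: cell_edge_def)
  then show ?thesis
    by (simp add: weight_def sum.reindex inj_on_def)
qed

lemma weight_copies_Inr:
  assumes "k < r" "j < n"
  shows "weight (copies r m n) f (k, Inr j) = (\<Sum>i<m. f (cell_edge k i j))"
proof -
  have "incident_edges (copies r m n) (k, Inr j) = (\<lambda>i. cell_edge k i j) ` {..<m}"
    using assms unfolding incident_edges_def edges_copies by (auto simp: cell_edge_def)
  then show ?thesis
    by (simp add: weight_def sum.reindex inj_on_def)
qed

lemma verts_copies:
  "verts (copies r m n) = {..<r} \<times> ({..<m} <+> {..<n})"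
  by (simp add: verts_def disjoint_copies_def complete_bipartite_def)

section \<open>The lower bound of three colors\<close>

lemma copies_card_weights_ge_3:
  assumes f: "local_antimagic_labeling (copies r m m) f" and "0 < r" "0 < m"
  shows "3 \<le> card (weight (copies r m m) f ` verts (copies r m m))"
proof (rule ccontr)
  let ?w = "weight (copies r m m) f"
  let ?L = "(\<lambda>i. ?w (0, Inl i)) ` {..<m}" and ?R = "(\<lambda>j. ?w (0, Inr j)) ` {..<m}"
  assume "\<not> ?thesis"
  then have small: "card (?w ` verts (copies r m m)) \<le> 2"
    by simp
  have "?L \<union> ?R \<subseteq> ?w ` verts (copies r m m)"
    using \<open>0 < r\<close> by (auto simp: verts_copies)
  then have "card (?L \<union> ?R) \<le> 2"
    using small card_mono[of "?w ` verts (copies r m m)" "?L \<union> ?R"] by (simp add: verts_copies)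
  moreover have "?w (0, Inl i) \<noteq> ?w (0, Inr j)" if "i < m" "j < m" for i j
  proof -
    have "{(0, Inl i), (0, Inr j)} \<in> edges (copies r m m)"
      using that \<open>0 < r\<close> by (auto simp: edges_copies cell_edge_def)
    then show ?thesis
      using f unfolding local_antimagic_labeling_def by blast
  qed
  then have "?L \<inter> ?R = {}"
    by auto
  ultimately have "card ?L + card ?R \<le> 2"
    by (simp add: card_Un_disjoint)
  moreover have "card ?L > 0" "card ?R > 0"
    using \<open>0 < m\<close> by (auto simp: card_gt_0_iff)
  ultimately have "card ?L = 1" "card ?R = 1"
    by linarith+
  then obtain a b where ab: "?L = {a}" "?R = {b}"
    by (meson card_1_singletonE)
  then have a: "\<And>i. i < m \<Longrightarrow> ?w (0, Inl i) = a" and b: "\<And>j. j < m \<Longrightarrow> ?w (0, Inr j) = b"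
    by blast+
  \<comment> \<open>The labels of component 0 are added up once by rows and once by columns.\<close>
  have "m * a = (\<Sum>i<m. ?w (0, Inl i))"
    by (simp add: a)
  also have "\<dots> = (\<Sum>i<m. \<Sum>j<m. f (cell_edge 0 i j))"
    using \<open>0 < r\<close> by (simp add: weight_copies_Inl)
  also have "\<dots> = (\<Sum>j<m. \<Sum>i<m. f (cell_edge 0 i j))"
    by (rule sum.swap)
  also have "\<dots> = (\<Sum>j<m. ?w (0, Inr j))"
    using \<open>0 < r\<close> by (simp add: weight_copies_Inr)
  also have "\<dots> = m * b"
    by (simp add: b)
  finally have "a = b"
    using \<open>0 < m\<close> by simp
  then show False
    using ab \<open>?L \<inter> ?R = {}\<close> by auto
qed

text \<open>Reduces the task to filling \<open>r\<close> matrices: with as many admissible labels as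
  edges, an injection is a bijection. In \<open>proper\<close> the sums rebind \<open>j\<close> and
  \<open>i\<close> respectively, so row \<open>i\<close> is compared with column
  \<open>j\<close>.\<close>

lemma copies_labeling_of_cells:
  fixes g :: "nat \<Rightarrow> nat \<Rightarrow> nat \<Rightarrow> nat"
  assumes inj: "\<And>k i j k' i' j'. \<lbrakk>k < r; i < m; j < n; k' < r; i' < m; j' < n;
      g k i j = g k' i' j'\<rbrakk> \<Longrightarrow> k = k' \<and> i = i' \<and> j = j'"
    and bound: "\<And>k i j. \<lbrakk>k < r; i < m; j < n\<rbrakk> \<Longrightarrow> g k i j \<in> {1..r * (m * n)}"
    and proper: "\<And>k i j. \<lbrakk>k < r; i < m; j < n\<rbrakk> \<Longrightarrow> (\<Sum>j<n. g k i j) \<noteq> (\<Sum>i<m. g k i j)"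
  obtains f where "local_antimagic_labeling (copies r m n) f"
    and "\<And>k i. \<lbrakk>k < r; i < m\<rbrakk> \<Longrightarrow> weight (copies r m n) f (k, Inl i) = (\<Sum>j<n. g k i j)"
    and "\<And>k j. \<lbrakk>k < r; j < n\<rbrakk> \<Longrightarrow> weight (copies r m n) f (k, Inr j) = (\<Sum>i<m. g k i j)"
proof
  \<comment> \<open>Distinct cells give distinct edges, so \<open>THE\<close> recovers the entry
    from the unordered edge.\<close>
  define f where "f e = (THE x. \<exists>k i j. e = cell_edge k i j \<and> x = g k i j)" for e
  have f [simp]: "f (cell_edge k i j) = g k i j" for k i j
    by (simp add: f_def)
  show L: "weight (copies r m n) f (k, Inl i) = (\<Sum>j<n. g k i j)" if "k < r" "i < m" for k i
    using that by (simp add: weight_copies_Inl)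
  show R: "weight (copies r m n) f (k, Inr j) = (\<Sum>i<m. g k i j)" if "k < r" "j < n" for k j
    using that by (simp add: weight_copies_Inr)
  let ?E = "edges (copies r m n)"
  have card: "card ?E = r * (m * n)"
    by (rule card_edges_disjoint_copies_complete_bipartite)
  have inj_f: "inj_on f ?E"
  proof (rule inj_onI)
    fix e e' assume "e \<in> ?E" "e' \<in> ?E" and eq: "f e = f e'"
    then obtain k i j k' i' j' where e: "e = cell_edge k i j" "e' = cell_edge k' i' j'"
      and "k < r" "i < m" "j < n" "k' < r" "i' < m" "j' < n"
      unfolding edges_copies by blast
    moreover have "g k i j = g k' i' j'"
      using eq by (simp add: e)
    ultimately show "e = e'"
      using inj by simp
  qed
  have "f ` ?E \<subseteq> {1..card ?E}"
    unfolding card using bound by (auto simp: edges_copies)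
  then have "f ` ?E = {1..card ?E}"
    by (intro card_subset_eq) (simp_all add: card_image[OF inj_f])
  moreover have "weight (copies r m n) f u \<noteq> weight (copies r m n) f v" if uv: "{u, v} \<in> ?E" for u v
  proof -
    obtain k i j where *: "k < r" "i < m" "j < n" "{u, v} = cell_edge k i j"
      using uv unfolding edges_copies by blast
    then consider "u = (k, Inl i)" "v = (k, Inr j)" | "u = (k, Inr j)" "v = (k, Inl i)"
      by (auto simp: cell_edge_def doubleton_eq_iff)
    then show ?thesis
      using * proper[of k i j] by cases (simp_all add: L R)
  qed
  ultimately show "local_antimagic_labeling (copies r m n) f"
    using inj_f by (simp add: local_antimagic_labeling_def bij_betw_def)
qed

section \<open>Kotzig arrays\<close>

lemma sum_reindex_lessThan:
  fixes p :: "nat \<Rightarrow> nat" and h :: "nat \<Rightarrow> 'a::comm_monoid_add"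
  assumes "inj_on p {..<m}" "\<And>i. i < m \<Longrightarrow> p i < m"
  shows "(\<Sum>i<m. h (p i)) = (\<Sum>i<m. h i)"
proof -
  have "p ` {..<m} = {..<m}"
    using assms by (intro endo_inj_surj) auto
  then show ?thesis
    using sum.reindex[OF assms(1), of h] by simp
qed

text \<open>For odd \<open>r\<close>, rows 0, 1, 2 add up to \<open>3 * (r div 2)\<close> at every
  \<open>k < r\<close>. The later rows alternate between identity and reversal, each such pair
  adding \<open>r - 1\<close>; pairs alone would give an even number of rows.\<close>

definition kotzig :: "nat \<Rightarrow> nat \<Rightarrow> nat \<Rightarrow> nat" where
  "kotzig r l k =
     (if l = 0 then k
      else if l = 1 then (if even k then r div 2 - k div 2 else r - 1 - k div 2)
      else if l = 2 then (if even k then r - 1 - k div 2 else r div 2 - 1 - k div 2)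
      else if odd l then k else r - 1 - k)"

lemma kotzig_less: "odd r \<Longrightarrow> k < r \<Longrightarrow> kotzig r l k < r"
  by (auto simp: kotzig_def elim!: oddE)

text \<open>In rows 1 and 2 the even and the odd \<open>k\<close> fill disjoint intervals of values,
  each in decreasing order.\<close>

lemma kotzig_inj:
  assumes "odd r" "k < r" "k' < r" "kotzig r l k = kotzig r l k'"
  shows "k = k'"
proof -
  obtain a where r: "r = 2 * a + 1"
    using \<open>odd r\<close> by (auto elim: oddE)
  show ?thesis
    using assms(2-4) unfolding kotzig_def r
    by (cases "even k"; cases "even k'") (auto elim!: evenE oddE split: if_splits)
qed

lemma sum_kotzig:
  assumes "odd r" "k < r" "odd m" "3 \<le> m"
  shows "2 * (\<Sum>l<m. kotzig r l k) = m * (r - 1)"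
proof -
  obtain a where r: "r = 2 * a + 1"
    using \<open>odd r\<close> by (auto elim: oddE)
  \<comment> \<open>\<open>t\<close> counts the pairs of rows after the three special ones.\<close>
  obtain t where m: "m = 2 * t + 3"
    using \<open>odd m\<close> \<open>3 \<le> m\<close> by (intro that[of "(m - 3) div 2"]) (auto elim!: oddE)
  have "(\<Sum>l<2 * t + 3. kotzig r l k) = (2 * t + 3) * a"
  proof (induction t)
    case 0
    have "kotzig r 0 k + kotzig r 1 k + kotzig r 2 k = 3 * a"
      using \<open>k < r\<close> unfolding r by (cases "even k") (auto simp: kotzig_def elim!: evenE oddE)
    then show ?case
      by (simp add: eval_nat_numeral)
  next
    case (Suc t)
    have "kotzig r (2 * t + 3) k + kotzig r (2 * t + 4) k = 2 * a"
      using \<open>k < r\<close> by (simp add: kotzig_def r)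
    moreover have "(\<Sum>l<2 * Suc t + 3. kotzig r l k) =
        (\<Sum>l<2 * t + 3. kotzig r l k) + kotzig r (2 * t + 3) k + kotzig r (2 * t + 4) k"
      by (simp add: eval_nat_numeral)
    ultimately show ?case
      using Suc.IH by (simp add: algebra_simps)
  qed
  then show ?thesis
    by (simp add: m r)
qed

section \<open>The square and its labeling\<close>

text \<open>The base-\<open>m\<close> digits are two Latin squares, orthogonal for odd
  \<open>m\<close>; adding \<open>m - 1 - j\<close> avoids negative residues. For
  \<open>j < m\<close>, row 0 is \<open>m * (m - 1) - (m - 1) * j\<close>.\<close>

definition square :: "nat \<Rightarrow> nat \<Rightarrow> nat \<Rightarrow> nat" where
  "square m i j = (i + j) mod m + m * ((i + (m - 1 - j)) mod m)"

definition rotate_row :: "nat \<Rightarrow> nat \<Rightarrow> nat \<Rightarrow> nat" where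
  "rotate_row m i j = (if i = 0 then Suc j mod m else j)"

text \<open>Square and Kotzig entry are digits in base \<open>m * m\<close>. The Kotzig row is
  chosen by the unrotated \<open>j\<close>, so every row and column of a component meets each Kotzig
  row once.\<close>

definition cell_label :: "nat \<Rightarrow> nat \<Rightarrow> nat \<Rightarrow> nat \<Rightarrow> nat \<Rightarrow> nat" where
  "cell_label r m k i j =
     1 + square m i (rotate_row m i j) + m * m * kotzig r ((i + j) mod m) k"

section \<open>Row and column sums of the square\<close>

lemma add_mod_inj_on: "inj_on (\<lambda>j. (i + j) mod m) {..<m::nat}"
proof (rule inj_onI)
  fix x y assume xy: "x \<in> {..<m}" "y \<in> {..<m}" and "(i + x) mod m = (i + y) mod m"
  then have "[i + x = i + y] (mod m)"
    by (simp add: cong_def)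
  then have "[x = y] (mod m)"
    by (simp only: cong_add_lcancel_nat)
  then show "x = y"
    using xy by (simp add: cong_def)
qed

lemma sum_add_mod:
  fixes h :: "nat \<Rightarrow> 'a::comm_monoid_add"
  shows "(\<Sum>j<m. h ((i + j) mod m)) = (\<Sum>j<m. h j)"
  by (intro sum_reindex_lessThan add_mod_inj_on) simp

lemma sum_add_mod':
  fixes h :: "nat \<Rightarrow> 'a::comm_monoid_add"
  shows "(\<Sum>i<m. h ((i + j) mod m)) = (\<Sum>i<m. h i)"
  using sum_add_mod[of h j m] by (simp add: add.commute)

lemma sum_square_row:
  "(\<Sum>j<m. square m i j) = (\<Sum>j<m. j) + m * (\<Sum>j<m. j)"
proof -
  have "(\<Sum>j<m. (i + (m - 1 - j)) mod m) = (\<Sum>j<m. (i + j) mod m)"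
    by (rule sum_reindex_lessThan[where p = "\<lambda>j. m - 1 - j"]) (auto simp: inj_on_def)
  then show ?thesis
    using sum_add_mod[of "\<lambda>x. x" i m]
    by (simp add: square_def sum.distrib flip: sum_distrib_left)
qed

lemma sum_square_col:
  "(\<Sum>i<m. square m i j) = (\<Sum>j<m. j) + m * (\<Sum>j<m. j)"
  using sum_add_mod'[of "\<lambda>x. x" j m] sum_add_mod'[of "\<lambda>x. x" "m - 1 - j" m]
  by (simp add: square_def sum.distrib flip: sum_distrib_left)

section \<open>Distinctness and range of the labels\<close>

lemma digits_inj:
  fixes a b c d n :: nat
  assumes "a + n * b = c + n * d" "a < n" "c < n"
  shows "a = c \<and> b = d"
proof -
  have "(a + n * b) mod n = a" "(a + n * b) div n = b"
    "(c + n * d) mod n = c" "(c + n * d) div n = d"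
    using assms(2,3) by simp_all
  then show ?thesis
    using assms(1) by metis
qed

lemma digits_less:
  fixes a b n q :: nat
  assumes "a < n" "b < q"
  shows "a + n * b < n * q"
proof -
  have "a + n * b < n * Suc b"
    using \<open>a < n\<close> by simp
  also have "\<dots> \<le> n * q"
    using \<open>b < q\<close> by (intro mult_le_mono2) simp
  finally show ?thesis .
qed

lemma square_less: "0 < m \<Longrightarrow> square m i j < m * m"
  by (simp add: square_def digits_less)

text \<open>Adding the two digits cancels \<open>j\<close> and leaves \<open>2 * i\<close> plus a
  constant modulo \<open>m\<close>; as \<open>m\<close> is odd, the factor 2 can be cancelled. The
  first digit then gives \<open>j\<close>.\<close>

lemma square_inj:
  assumes "odd m" "i < m" "j < m" "i' < m" "j' < m" "square m i j = square m i' j'"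
  shows "i = i' \<and> j = j'"
proof -
  have "[i + j = i' + j'] (mod m)" "[i + (m - 1 - j) = i' + (m - 1 - j')] (mod m)"
    using digits_inj[OF assms(6)[unfolded square_def]] \<open>i < m\<close> by (simp_all add: cong_def)
  then have "[(i + j) + (i + (m - 1 - j)) = (i' + j') + (i' + (m - 1 - j'))] (mod m)"
    by (rule cong_add)
  moreover have "(i + j) + (i + (m - 1 - j)) = 2 * i + (m - 1)"
    "(i' + j') + (i' + (m - 1 - j')) = 2 * i' + (m - 1)"
    using assms(3,5) by auto
  ultimately have "[2 * i = 2 * i'] (mod m)"
    by (simp only: cong_add_rcancel_nat)
  moreover have "coprime 2 m"
    using \<open>odd m\<close> by simp
  ultimately have "[i = i'] (mod m)"
    by (simp add: cong_mult_lcancel_nat)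
  then have "i = i'"
    using assms(2,4) by (simp add: cong_def)
  then have "[j = j'] (mod m)"
    using \<open>[i + j = i' + j'] (mod m)\<close> by (simp add: cong_add_lcancel_nat)
  with \<open>i = i'\<close> show ?thesis
    using assms(3,5) by (simp add: cong_def)
qed

lemma rotate_row_less: "j < m \<Longrightarrow> rotate_row m i j < m"
  by (simp add: rotate_row_def)

lemma rotate_row_inj: "inj_on (rotate_row m i) {..<m}"
proof (cases "i = 0")
  case True
  then have "rotate_row m i = (\<lambda>j. (1 + j) mod m)"
    by (simp add: fun_eq_iff rotate_row_def)
  then show ?thesis
    by (simp only: add_mod_inj_on)
next
  case False
  then show ?thesis
    by (simp add: rotate_row_def inj_on_def)
qed

text \<open>The square entry yields \<open>i\<close> and \<open>j\<close> first; only then is the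
  Kotzig row known to agree on both sides, and its injectivity yields \<open>k\<close>.\<close>

lemma cell_label_inj:
  assumes "odd m" "odd r" "k < r" "i < m" "j < m" "k' < r" "i' < m" "j' < m"
    and eq: "cell_label r m k i j = cell_label r m k' i' j'"
  shows "k = k' \<and> i = i' \<and> j = j'"
proof -
  have sq: "square m i (rotate_row m i j) = square m i' (rotate_row m i' j')"
    and ko: "kotzig r ((i + j) mod m) k = kotzig r ((i' + j') mod m) k'"
    using eq \<open>i < m\<close> digits_inj[of "square m i (rotate_row m i j)" "m * m" _
        "square m i' (rotate_row m i' j')"]
    by (simp_all add: cell_label_def square_less)
  have ij: "i = i' \<and> rotate_row m i j = rotate_row m i' j'"
    using square_inj[OF \<open>odd m\<close> \<open>i < m\<close> _ \<open>i' < m\<close> _ sq] rotate_row_less assms(5,8) by blast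
  then have "j = j'"
    using inj_onD[OF rotate_row_inj, of m i j j'] assms(5,8) by auto
  with ij ko show ?thesis
    using kotzig_inj[of r k k' "(i + j) mod m"] assms(2,3,6) by simp
qed

lemma cell_label_bound:
  assumes "odd r" "k < r" "i < m" "j < m"
  shows "cell_label r m k i j \<in> {1..r * (m * m)}"
proof -
  have "square m i (rotate_row m i j) + m * m * kotzig r ((i + j) mod m) k < m * m * r"
    using assms by (intro digits_less square_less kotzig_less) auto
  then show ?thesis
    by (simp add: cell_label_def mult.commute[of r])
qed

text \<open>The summands come from the offsets 1, the magic sum of \<open>square\<close> and the
  Kotzig sum. Without the rotation this would also be every column sum.\<close>

definition row_weight :: "nat \<Rightarrow> nat \<Rightarrow> nat" where
  "row_weight r m = m + ((\<Sum>j<m. j) + m * (\<Sum>j<m. j)) + m * m * (m * (r - 1) div 2)"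

section \<open>Row and column sums of the labels\<close>

context
  fixes r m k :: nat
  assumes odd_r: "odd r" and k: "k < r" and odd_m: "odd m" and m: "3 \<le> m"
begin

lemma sum_kotzig_div_2: "(\<Sum>l<m. kotzig r l k) = m * (r - 1) div 2"
  using sum_kotzig[OF odd_r k odd_m m] by simp

lemma sum_cell_label_row:
  "(\<Sum>j<m. cell_label r m k i j) = row_weight r m"
proof -
  have "(\<Sum>j<m. square m i (rotate_row m i j)) = (\<Sum>j<m. square m i j)"
    by (intro sum_reindex_lessThan rotate_row_inj rotate_row_less)
  moreover have "(\<Sum>j<m. kotzig r ((i + j) mod m) k) = (\<Sum>l<m. kotzig r l k)"
    by (rule sum_add_mod)
  ultimately show ?thesis
    by (simp add: cell_label_def sum.distrib sum_Suc row_weight_def sum_square_row sum_kotzig_div_2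
        flip: sum_distrib_left)
qed

text \<open>The rotation replaces one entry of column \<open>j\<close>, the one in row 0. The change
  may be negative, hence the terms added on both sides.\<close>

lemma sum_cell_label_col:
  "(\<Sum>i<m. cell_label r m k i j) + square m 0 j =
     row_weight r m + square m 0 (Suc j mod m)"
proof -
  have split: "(\<Sum>i<m. h i) = h 0 + (\<Sum>i\<in>{1..<m}. h i)" for h :: "nat \<Rightarrow> nat"
    using m by (simp add: lessThan_atLeast0 sum.atLeast_Suc_lessThan)
  have "(\<Sum>i<m. square m i (rotate_row m i j)) + square m 0 j =
      (\<Sum>i<m. square m i j) + square m 0 (Suc j mod m)"
    by (simp add: split rotate_row_def)
  moreover have "(\<Sum>i<m. kotzig r ((i + j) mod m) k) = (\<Sum>l<m. kotzig r l k)"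
    by (rule sum_add_mod')
  ultimately show ?thesis
    by (simp add: cell_label_def sum.distrib sum_Suc row_weight_def sum_square_col sum_kotzig_div_2
        flip: sum_distrib_left)
qed

text \<open>Row 0 of \<open>square\<close> falls by \<open>m - 1\<close> at each step and rises by
  \<open>(m - 1) * (m - 1)\<close> at the wrap from column \<open>m - 1\<close> to column 0.\<close>

lemma sum_cell_label_col_cases:
  assumes "j < m"
  shows "(\<Sum>i<m. cell_label r m k i j) =
    (if j = m - 1 then row_weight r m + (m - 1) * (m - 1) else row_weight r m - (m - 1))"
proof (cases "j = m - 1")
  case True
  then show ?thesis
    using sum_cell_label_col[of j] m by (cases m) (simp_all add: square_def)
next
  case False
  \<comment> \<open>The second digits of row 0 in columns \<open>j\<close> and \<open>j + 1\<close>
    become \<open>d + 1\<close> and \<open>d\<close>.\<close>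
  then obtain d where "m = j + d + 2"
    using \<open>j < m\<close> by (intro that[of "m - j - 2"]) simp
  then show ?thesis
    using sum_cell_label_col[of j] by (simp add: square_def algebra_simps)
qed

end

theorem theorem2p4:
  fixes m r :: nat
  assumes "odd m" and "3 \<le> m" and "odd r" and "1 \<le> r"
  shows "local_antimagic_chromatic_number (disjoint_copies r (complete_bipartite m m)) = 3"
proof -
  let ?C = "row_weight r m"
  let ?W = "{?C, ?C - (m - 1), ?C + (m - 1) * (m - 1)}"
  note col = sum_cell_label_col_cases[OF assms(3) _ assms(1,2)]
  note row = sum_cell_label_row[OF assms(3) _ assms(1,2)]
  have proper: "(\<Sum>j<m. cell_label r m k i j) \<noteq> (\<Sum>i<m. cell_label r m k i j)"
    if "k < r" "j < m" for k i j
  proof -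
    \<comment> \<open>This makes the truncated difference \<open>?C - (m - 1)\<close> strictly
      smaller than \<open>?C\<close>.\<close>
    have "m \<le> ?C"
      by (simp add: row_weight_def)
    then show ?thesis
      using that assms(2) by (simp add: row col) linarith
  qed
  obtain f where f: "local_antimagic_labeling (copies r m m) f"
    and L: "\<And>k i. \<lbrakk>k < r; i < m\<rbrakk> \<Longrightarrow>
        weight (copies r m m) f (k, Inl i) = (\<Sum>j<m. cell_label r m k i j)"
    and R: "\<And>k j. \<lbrakk>k < r; j < m\<rbrakk> \<Longrightarrow>
        weight (copies r m m) f (k, Inr j) = (\<Sum>i<m. cell_label r m k i j)"
  proof (rule copies_labeling_of_cells[of r m m "cell_label r m"])
    show "k = k' \<and> i = i' \<and> j = j'"
      if "k < r" "i < m" "j < m" "k' < r" "i' < m" "j' < m"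
        "cell_label r m k i j = cell_label r m k' i' j'" for k i j k' i' j'
      using that by (rule cell_label_inj[OF assms(1,3)])
    show "cell_label r m k i j \<in> {1..r * (m * m)}" if "k < r" "i < m" "j < m" for k i j
      using that by (rule cell_label_bound[OF assms(3)])
  qed (use proper in blast)+
  have "weight (copies r m m) f ` verts (copies r m m) \<subseteq> ?W"
    by (auto simp: verts_copies L R row col)
  then have "card (weight (copies r m m) f ` verts (copies r m m)) \<le> card ?W"
    by (intro card_mono) simp_all
  also have "\<dots> \<le> 3"
    by (simp add: card_insert_if)
  finally have "card (weight (copies r m m) f ` verts (copies r m m)) \<le> 3" .
  moreover have lower: "3 \<le> card (weight (copies r m m) f ` verts (copies r m m))"
    if "local_antimagic_labeling (copies r m m) f" for f
    using copies_card_weights_ge_3[OF that] assms by simp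
  ultimately have "card (weight (copies r m m) f ` verts (copies r m m)) = 3"
    using f by (simp add: le_antisym)
  then show ?thesis
    unfolding local_antimagic_chromatic_number_def
  \<comment> \<open>The labeling \<open>f\<close> attains 3, so \<open>Inf\<close> is a true minimum
    and not the default 0 of the empty set.\<close>
  proof (intro cInf_eq_minimum)
    show "3 \<in> {card (weight (copies r m m) f ` verts (copies r m m)) | f.
        local_antimagic_labeling (copies r m m) f}"
      using f \<open>_ = 3\<close> by (metis (mono_tags, lifting) mem_Collect_eq)
  qed (use lower in blast)
qed

end
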